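(* Suppose that $X$ and $Y$ are Polish spaces and $f \colon X \to Y$ is an $F_\sigma$-to-one Borel function. Then $f$ is strongly $\sigma$-closed-to-one.
   Context: A subset of a topological space is $F_\sigma$ if it is a union of countably-many closed sets, and analytic if it is a continuous image of a closed subset of $\mathbb{N}^{\mathbb{N}}$. A function between topological spaces is Borel if preimages of open sets are Borel; $F_\sigma$-to-one if the preimage of each singleton is $F_\sigma$; and strongly $\sigma$-closed-to-one if its domain is a union of countably-many analytic sets, each of which intersects the preimage of each singleton in a closed set. *)

theory Defs
  imports "HOL-Analysis.Analysis"
begin

text \<open>The Baire space is the type \<^typ>\<open>nat \<Rightarrow> nat\<close> with its product topology. A Polish space
  is a type of class \<^class>\<open>polish_space\<close>; only the topology of the type, and not its complete
  metric, is used below.\<close>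

definition analytic_set :: "'a::topological_space set \<Rightarrow> bool" where
  "analytic_set A \<longleftrightarrow>
     (\<exists>(C :: (nat \<Rightarrow> nat) set) g. closed C \<and> continuous_on C g \<and> g ` C = A)"

definition fsigma_to_one :: "('a::topological_space \<Rightarrow> 'b) \<Rightarrow> bool" where
  "fsigma_to_one f \<longleftrightarrow> (\<forall>y. fsigma (f -` {y}))"

text \<open>The sets \<open>A n \<inter> f -` {y}\<close> are closed in the whole domain, not just relative to \<open>A n\<close>.
  Families indexed by the naturals include the finite ones, as the empty set is analytic.\<close>

definition strongly_sigma_closed_to_one :: "('a::topological_space \<Rightarrow> 'b) \<Rightarrow> bool" where
  "strongly_sigma_closed_to_one f \<longleftrightarrow>
     (\<exists>A :: nat \<Rightarrow> 'a set. (\<Union>n. A n) = UNIV \<and> (\<forall>n. analytic_set (A n)) \<and>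
        (\<forall>n y. closed (A n \<inter> f -` {y})))"

end

theory Submission
  imports Defs
begin

text \<open>Every fibre being a countable union of closed sets, the difficulty is to find pieces that work
  for all fibres at once. Call a set closed-fibred if it is Borel and meets each fibre of \<open>f\<close> in a
  closed set, and small if it is a countable union of closed-fibred sets. Borel sets in Polish spaces
  are analytic, so it is enough that the whole domain is small.

  Closed-fibred sets are found by separation. Suppose that \<open>S\<close> is a set such that the closure of each
  \<open>S \<inter> f -` {y}\<close> stays inside \<open>f -` {y}\<close>. With a countable base \<open>U k\<close> this says that every pair
  \<open>(x, y)\<close> with \<open>f x \<noteq> y\<close> lies in some \<open>U k \<times> - H k\<close> with \<open>H k = f ` (S \<inter> U k)\<close>. If \<open>S\<close> is analytic then
  so are the \<open>H k\<close>, and they can be enlarged to Borel sets without losing this covering property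
  (\<open>cover_separation\<close>); the points \<open>x\<close> such that \<open>f x\<close> lies in the enlarged \<open>H k\<close> whenever
  \<open>x \<in> U k\<close> then form a closed-fibred superset of \<open>S\<close> (\<open>closed_fibred_cover\<close>). Consequently an analytic
  set that is not contained in a small one has, in some fibre, a sequence that converges to a point
  outside that fibre.

  If the domain is not small, this is iterated, in the manner of the \<open>G\<^sub>0\<close> dichotomy, to build a
  countable subset of one single fibre to each point of which, and however close to it, such
  sequences are attached (\<open>configs\<close>, \<open>large_extend\<close>, \<open>large_split\<close>). The closeness is measured in a
  finer topology: the graph of \<open>f\<close> is a continuous image of the Baire space, and the points are
  represented by their codes there. By the Baire category theorem in the closure of the set of
  codes, that fibre is not a countable union of closed sets (\<open>no_full_config\<close>).\<close>

section \<open>Cylinders in sequence spaces\<close>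

definition cyl :: "(nat \<Rightarrow> 'a) \<Rightarrow> nat \<Rightarrow> (nat \<Rightarrow> 'a) set" where
  "cyl u n = {v. \<forall>i<n. v i = u i}"

lemma open_cyl: "open (cyl (u :: nat \<Rightarrow> 'a::discrete_topology) n)"
proof -
  have "open {v. \<forall>i\<in>{..<n}. v i \<in> {u i}}"
    by (rule product_topology_basis') (auto simp: open_discrete)
  then show ?thesis by (simp add: cyl_def Ball_def)
qed

lemma cyl_self [simp]: "u \<in> cyl u n" by (simp add: cyl_def)

lemma cyl_mono: "m \<le> n \<Longrightarrow> cyl u n \<subseteq> cyl u m" by (auto simp: cyl_def)

lemma cyl_cong: "v \<in> cyl u n \<Longrightarrow> cyl v n = cyl u n"
  by (auto simp: cyl_def)

lemma cyl_split: "cyl u n = (\<Union>c. cyl (u(n := c)) (Suc n))"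
  by (auto simp: cyl_def less_Suc_eq)

lemma open_contains_cyl:
  fixes u :: "nat \<Rightarrow> 'a::topological_space"
  assumes "open U" "u \<in> U"
  shows "\<exists>n. cyl u n \<subseteq> U"
proof -
  have "openin (product_topology (\<lambda>i. euclidean) UNIV) U"
    using assms(1) by (simp add: open_fun_def)
  from product_topology_open_contains_basis[OF this assms(2)]
  obtain X where X: "u \<in> (\<Pi>\<^sub>E i\<in>UNIV. X i)" "finite {i. X i \<noteq> UNIV}" "(\<Pi>\<^sub>E i\<in>UNIV. X i) \<subseteq> U"
    by auto
  obtain n where n: "\<And>i. X i \<noteq> UNIV \<Longrightarrow> i < n"
    using X(2) by (metis (mono_tags, lifting) finite_nat_set_iff_bounded mem_Collect_eq)
  have "cyl u n \<subseteq> (\<Pi>\<^sub>E i\<in>UNIV. X i)"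
    using X(1) n by (fastforce simp: cyl_def PiE_iff)
  with X(3) show ?thesis by blast
qed

lemma continuous_on_cylI:
  fixes g :: "(nat \<Rightarrow> 'a::discrete_topology) \<Rightarrow> 'b::topological_space"
  assumes "\<And>u V. open V \<Longrightarrow> u \<in> S \<Longrightarrow> g u \<in> V \<Longrightarrow> \<exists>n. \<forall>v\<in>cyl u n \<inter> S. g v \<in> V"
  shows "continuous_on S g"
  unfolding continuous_on_topological
proof (intro ballI allI impI)
  fix u V assume "u \<in> S" "open V" "g u \<in> V"
  then obtain n where "\<forall>v\<in>cyl u n \<inter> S. g v \<in> V" using assms by blast
  then show "\<exists>A. open A \<and> u \<in> A \<and> (\<forall>y\<in>S. y \<in> A \<longrightarrow> g y \<in> V)"
    using open_cyl[of u n] cyl_self by blast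
qed

lemma continuous_cylD:
  fixes g :: "(nat \<Rightarrow> 'a::topological_space) \<Rightarrow> 'b::topological_space"
  assumes "continuous_on UNIV g" "open V" "g u \<in> V"
  shows "\<exists>n. \<forall>v\<in>cyl u n. g v \<in> V"
proof -
  have "open (g -` V)" using assms(1,2) by (simp add: continuous_on_open_vimage)
  then have "\<exists>n. cyl u n \<subseteq> g -` V" using assms(3) by (intro open_contains_cyl) auto
  then show ?thesis by blast
qed

lemma mem_closed_cylI:
  fixes C :: "(nat \<Rightarrow> 'a::topological_space) set"
  assumes "closed C" "\<And>n. cyl u n \<inter> C \<noteq> {}"
  shows "u \<in> C"
proof (rule ccontr)
  assume "u \<notin> C"
  then obtain n where "cyl u n \<subseteq> - C"
    using open_contains_cyl[of "- C" u] assms(1) by (auto simp: open_Compl)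
  with assms(2)[of n] show False by blast
qed

text \<open>The limit of successive approximations, the \<open>n\<close>-th of which fixes the entries below \<open>n\<close> for good.\<close>
lemma cyl_coherent:
  assumes "\<And>n. U (Suc n) \<in> cyl (U n) n"
  shows "U n \<in> cyl (\<lambda>i. U (Suc i) i) n"
proof -
  have later: "U (n + k) \<in> cyl (U n) n" for n k
  proof (induction k)
    case (Suc k)
    have "U (n + Suc k) \<in> cyl (U (n + k)) (n + k)" using assms[of "n + k"] by simp
    then show ?case using Suc by (auto simp: cyl_def)
  qed simp
  show ?thesis
    unfolding cyl_def
  proof (intro CollectI allI impI)
    fix i assume "i < n"
    then obtain k where "n = Suc i + k" using less_iff_Suc_add by auto
    then show "U n i = U (Suc i) i" using later[of "Suc i" k] by (auto simp: cyl_def)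
  qed
qed

text \<open>The choice of a branch, for constructions that decide one entry at a time while keeping a property
  of the cylinder reached so far.\<close>
lemma cyl_branch:
  assumes "Q 0 UNIV"
    and "\<And>n u. Q n (cyl u n) \<Longrightarrow> \<exists>v\<in>cyl u n. Q (Suc n) (cyl v (Suc n))"
  shows "\<exists>u. \<forall>n. Q n (cyl u n)"
proof -
  have "\<exists>U. \<forall>n. Q n (cyl (U n) n) \<and> U (Suc n) \<in> cyl (U n) n"
  proof (rule dependent_nat_choice[where P = "\<lambda>n u. Q n (cyl u n)" and Q = "\<lambda>n u v. v \<in> cyl u n"])
    show "\<exists>u. Q 0 (cyl u 0)" using assms(1) by (simp add: cyl_def)
    show "\<exists>v. Q (Suc n) (cyl v (Suc n)) \<and> v \<in> cyl u n" if "Q n (cyl u n)" for u n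
      using assms(2)[OF that] by blast
  qed
  then obtain U where U: "\<And>n. Q n (cyl (U n) n)" "\<And>n. U (Suc n) \<in> cyl (U n) n" by blast
  have "cyl (U n) n = cyl (\<lambda>i. U (Suc i) i) n" for n
    by (rule cyl_cong[OF cyl_coherent]) (rule U(2))
  with U(1) have "\<forall>n. Q n (cyl (\<lambda>i. U (Suc i) i) n)" by simp
  then show ?thesis by blast
qed

text \<open>Follow \<open>w\<close> as long as some element of \<open>C\<close> does so, and otherwise stay on an element of \<open>C\<close>
  already found. The gain is that nonempty analytic sets become ranges of functions that are
  continuous on the whole Baire space.\<close>
lemma closed_retract:
  fixes C :: "(nat \<Rightarrow> 'a::discrete_topology) set"
  assumes "closed C" "C \<noteq> {}"
  shows "\<exists>r :: _ \<Rightarrow> nat \<Rightarrow> 'a. continuous_on UNIV r \<and> range r = C \<and> (\<forall>u\<in>C. r u = u)"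
proof -
  obtain c0 where c0: "c0 \<in> C" using assms by blast
  define step where "step w n a = (if \<exists>c\<in>C. c \<in> cyl a n \<and> c n = w n
     then SOME c. c \<in> C \<and> c \<in> cyl a n \<and> c n = w n else a)" for w n a
  define A where "A w = rec_nat c0 (step w)" for w
  have A0: "A w 0 = c0" and AS: "A w (Suc n) = step w n (A w n)" for w n
    by (simp_all add: A_def)
  have step: "step w n a \<in> C \<and> step w n a \<in> cyl a n \<and>
      ((\<exists>c\<in>C. c \<in> cyl a n \<and> c n = w n) \<longrightarrow> step w n a n = w n)" if "a \<in> C" for w n a
  proof (cases "\<exists>c\<in>C. c \<in> cyl a n \<and> c n = w n")
    case True
    then have "\<exists>c. c \<in> C \<and> c \<in> cyl a n \<and> c n = w n" by blast
    from someI_ex[OF this] True show ?thesis by (simp add: step_def)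
  next
    case False
    then show ?thesis using that by (auto simp: step_def)
  qed
  have AC: "A w n \<in> C" for w n
    by (induction n) (use c0 step in \<open>auto simp: A0 AS\<close>)
  define r where "r w = (\<lambda>n. A w (Suc n) n)" for w
  have rA: "A w n \<in> cyl (r w) n" for w n
    unfolding r_def using cyl_coherent[of "A w"] step[OF AC] by (simp add: AS)
  have rC: "r w \<in> C" for w
    by (rule mem_closed_cylI[OF assms(1)]) (use AC rA in blast)
  have id: "r w = w" if "w \<in> C" for w
  proof -
    have "A w n \<in> cyl w n" for n
    proof (induction n)
      case (Suc n)
      then have "w \<in> cyl (A w n) n" by (auto simp: cyl_def)
      then have "A w (Suc n) n = w n" "A w (Suc n) \<in> cyl (A w n) n"
        using step[OF AC, of w n w n] that by (simp_all add: AS) blast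
      then show ?case using Suc by (auto simp: cyl_def less_Suc_eq)
    qed (auto simp: cyl_def)
    then show ?thesis by (auto simp: r_def cyl_def fun_eq_iff)
  qed
  have loc: "A v n = A w n" if "v \<in> cyl w n" for v w n
    using that
  proof (induction n)
    case (Suc n)
    then have "v \<in> cyl w n" "v n = w n" by (auto simp: cyl_def)
    then have "A v n = A w n" using Suc by blast
    with \<open>v n = w n\<close> show ?case by (simp only: AS step_def)
  qed (simp add: A0)
  have "continuous_on UNIV r"
  proof (rule continuous_on_cylI)
    fix u V assume "open V" "r u \<in> V"
    then obtain n where n: "cyl (r u) n \<subseteq> V" using open_contains_cyl[of V] by blast
    have "r v \<in> cyl (r u) n" if "v \<in> cyl u n" for v
      using rA[of v n] rA[of u n] loc[OF that] by (auto simp: cyl_def)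
    then show "\<exists>n. \<forall>v\<in>cyl u n \<inter> UNIV. r v \<in> V" using n by blast
  qed
  moreover have "range r = C" using rC id by (metis image_subset_iff rangeI subsetI subset_antisym)
  ultimately show ?thesis using id by blast
qed

text \<open>The Baire category theorem, in the closed subspace \<open>P\<close> of the Baire space.\<close>
lemma baire_closed_cover:
  fixes P :: "(nat \<Rightarrow> nat) set" and F :: "nat \<Rightarrow> (nat \<Rightarrow> nat) set"
  assumes "closed P" "P \<noteq> {}" "P \<subseteq> (\<Union>n. F n)" "\<And>n. closed (F n)"
  shows "\<exists>n u m. u \<in> P \<and> P \<inter> cyl u m \<subseteq> F n"
proof (rule ccontr)
  assume none: "\<not> ?thesis"
  let ?X = "top_of_set P"
  have nat: "(euclidean :: nat topology) = discrete_topology UNIV"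
    by (rule discrete_topology_unique[THEN iffD2, symmetric]) (simp add: open_discrete)
  have "completely_metrizable_space (euclidean :: (nat \<Rightarrow> nat) topology)"
    unfolding euclidean_product_topology[symmetric] completely_metrizable_space_product_topology
    by (simp add: nat completely_metrizable_space_discrete_topology)
  then have "completely_metrizable_space ?X"
    using completely_metrizable_space_closedin assms(1) by (metis closed_closedin)
  moreover have "closedin ?X T \<and> ?X interior_of T = {}" if T: "T \<in> range (\<lambda>n. P \<inter> F n)" for T
  proof -
    obtain n where n: "T = P \<inter> F n" using T by blast
    have "?X interior_of T = {}"
    proof (rule ccontr)
      assume "?X interior_of T \<noteq> {}"
      then obtain u where u: "u \<in> ?X interior_of T" by blast
      then obtain W where W: "openin ?X W" "u \<in> W" "W \<subseteq> T" by (auto simp: interior_of_def)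
      then obtain O' where O': "open O'" "W = P \<inter> O'" by (auto simp: openin_open)
      then obtain m where "cyl u m \<subseteq> O'" using open_contains_cyl W(2) by blast
      then have "u \<in> P" "P \<inter> cyl u m \<subseteq> F n" using W O' n by blast+
      with none show False by blast
    qed
    then show ?thesis using assms(4) by (auto simp: n closedin_closed_Int)
  qed
  ultimately have "?X interior_of \<Union>(range (\<lambda>n. P \<inter> F n)) = {}"
    by (intro Baire_category_alt) auto
  moreover have "\<Union>(range (\<lambda>n. P \<inter> F n)) = P" using assms(3) by blast
  ultimately show False using assms(2) interior_of_topspace[of ?X] by simp
qed

section \<open>Sequences of sequences\<close>

text \<open>A single sequence carries countably many sequences, by the pairing of the naturals. A cylinder of
  the carrier fixes only finitely many entries, so it constrains only finitely many tracks.\<close>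
definition track :: "(nat \<Rightarrow> 'a) \<Rightarrow> nat \<Rightarrow> nat \<Rightarrow> 'a" where
  "track u i l = u (prod_encode (i, l))"

lemma continuous_track [continuous_intros]:
  "continuous_on UNIV (\<lambda>u :: nat \<Rightarrow> 'a::topological_space. track u i)"
  unfolding track_def by (intro continuous_on_coordinatewise_then_product continuous_on_product_coordinates)

lemma continuous_on_track:
  fixes g :: "(nat \<Rightarrow> 'a::topological_space) \<Rightarrow> 'b::topological_space"
  assumes "continuous_on UNIV g"
  shows "continuous_on UNIV (\<lambda>u. g (track u i))"
  using continuous_on_compose2[OF assms continuous_track] by simp

definition interleave :: "(nat \<Rightarrow> nat \<Rightarrow> 'a) \<Rightarrow> nat \<Rightarrow> 'a" where
  "interleave w m = (case prod_decode m of (i, l) \<Rightarrow> w i l)"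

lemma track_interleave [simp]: "track (interleave w) = w"
  by (intro ext) (simp add: track_def interleave_def)

text \<open>Deciding the entry \<open>n\<close> of the carrier refines one track only, namely the one in which \<open>n\<close> lies.\<close>
lemma track_cyl_split:
  assumes "i \<noteq> fst (prod_decode n)"
  shows "(\<lambda>v. track v i) ` cyl u n = (\<lambda>v. track v i) ` cyl (u(n := c)) (Suc n)"
proof
  show "(\<lambda>v. track v i) ` cyl u n \<subseteq> (\<lambda>v. track v i) ` cyl (u(n := c)) (Suc n)"
  proof
    fix w assume "w \<in> (\<lambda>v. track v i) ` cyl u n"
    then obtain v where v: "v \<in> cyl u n" "w = track v i" by blast
    have "prod_encode (i, l) \<noteq> n" for l using assms by auto
    then have "track (v(n := c)) i = w" by (simp add: v(2) track_def fun_eq_iff)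
    moreover have "v(n := c) \<in> cyl (u(n := c)) (Suc n)"
      using v(1) by (auto simp: cyl_def)
    ultimately show "w \<in> (\<lambda>v. track v i) ` cyl (u(n := c)) (Suc n)" by blast
  qed
  show "(\<lambda>v. track v i) ` cyl (u(n := c)) (Suc n) \<subseteq> (\<lambda>v. track v i) ` cyl u n"
    using cyl_split[of u n] by blast
qed

section \<open>Analytic sets\<close>

lemma analytic_setI:
  fixes C :: "(nat \<Rightarrow> nat) set"
  shows "closed C \<Longrightarrow> continuous_on C g \<Longrightarrow> analytic_set (g ` C)"
  unfolding analytic_set_def by blast

lemma analytic_set_empty: "analytic_set {}"
  using analytic_setI[of "{}"] by simp

lemma analytic_set_range:
  assumes "analytic_set A" "A \<noteq> {}"
  shows "\<exists>g :: (nat \<Rightarrow> nat) \<Rightarrow> _. continuous_on UNIV g \<and> range g = A"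
proof -
  obtain C :: "(nat \<Rightarrow> nat) set" and h where C: "closed C" "continuous_on C h" "h ` C = A"
    using assms(1) unfolding analytic_set_def by blast
  have "C \<noteq> {}" using assms(2) C(3) by blast
  obtain r :: "(nat \<Rightarrow> nat) \<Rightarrow> (nat \<Rightarrow> nat)" where r: "continuous_on UNIV r" "range r = C"
    using closed_retract[OF C(1) \<open>C \<noteq> {}\<close>] by blast
  then have "continuous_on UNIV (h \<circ> r)" using C(2) by (intro continuous_on_compose) auto
  moreover have "range (h \<circ> r) = A" using r C by (metis image_comp)
  ultimately show ?thesis by blast
qed

lemma analytic_set_image:
  assumes "analytic_set A" "continuous_on A h"
  shows "analytic_set (h ` A)"
proof -
  obtain C :: "(nat \<Rightarrow> nat) set" and g where C: "closed C" "continuous_on C g" "g ` C = A"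
    using assms(1) unfolding analytic_set_def by blast
  then have "continuous_on C (h \<circ> g)" using assms(2) by (intro continuous_on_compose) auto
  then show ?thesis using analytic_setI[OF C(1)] C(3) by (metis image_comp)
qed

text \<open>The first entry chooses the set, and the remaining ones name an element of it.\<close>
lemma analytic_set_UN:
  fixes A :: "nat \<Rightarrow> 'a::topological_space set"
  assumes "\<And>n. analytic_set (A n)"
  shows "analytic_set (\<Union>n. A n)"
proof -
  have "\<exists>h :: (nat \<Rightarrow> nat) \<Rightarrow> 'a. continuous_on UNIV h \<and> (A n \<noteq> {} \<longrightarrow> range h = A n)" for n
  proof (cases "A n = {}")
    case True
    then show ?thesis by (intro exI[of _ "\<lambda>_. undefined"]) simp
  next
    case False
    then show ?thesis using analytic_set_range[OF assms False] by simp
  qed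
  then obtain h :: "nat \<Rightarrow> (nat \<Rightarrow> nat) \<Rightarrow> 'a"
    where h: "\<And>n. continuous_on UNIV (h n)" "\<And>n. A n \<noteq> {} \<Longrightarrow> range (h n) = A n"
    by metis
  define C where "C = {w::nat \<Rightarrow> nat. A (w 0) \<noteq> {}}"
  define g where "g w = h (w 0) (\<lambda>i. w (Suc i))" for w
  have "C = (\<lambda>w. w 0) -` {n. A n \<noteq> {}}" by (auto simp: C_def)
  moreover have "closed ((\<lambda>w::nat\<Rightarrow>nat. w 0) -` {n. A n \<noteq> {}})"
    by (intro closed_vimage continuous_on_product_coordinates) (simp add: closed_def open_discrete)
  ultimately have "closed C" by simp
  moreover have "continuous_on C g"
  proof (rule continuous_on_cylI)
    fix u V assume "open V" "g u \<in> V"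
    then obtain n where n: "\<forall>v\<in>cyl (\<lambda>i. u (Suc i)) n. h (u 0) v \<in> V"
      using continuous_cylD[OF h(1) \<open>open V\<close>] unfolding g_def by blast
    have "g v \<in> V" if "v \<in> cyl u (Suc n)" for v
      using bspec[OF n, of "\<lambda>i. v (Suc i)"] that by (auto simp: g_def cyl_def)
    then show "\<exists>n. \<forall>v\<in>cyl u n \<inter> C. g v \<in> V" by blast
  qed
  moreover have "g ` C = (\<Union>n. A n)"
  proof
    show "g ` C \<subseteq> (\<Union>n. A n)" using h(2) by (auto simp: g_def C_def)
    show "(\<Union>n. A n) \<subseteq> g ` C"
    proof
      fix x assume "x \<in> (\<Union>n. A n)"
      then obtain n where n: "x \<in> A n" by blast
      then obtain w where "x = h n w" using h(2) by blast
      with n show "x \<in> g ` C" by (auto intro!: image_eqI[of _ _ "case_nat n w"] simp: g_def C_def)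
    qed
  qed
  ultimately show ?thesis unfolding analytic_set_def by blast
qed

text \<open>An element of the intersection is named by a sequence of codes, one for each set, that all
  have the same value; the set of these sequences is closed.\<close>
lemma analytic_set_INT:
  fixes A :: "nat \<Rightarrow> (nat \<Rightarrow> 'a::t2_space) set"
  assumes "\<And>n. analytic_set (A n)"
  shows "analytic_set (\<Inter>n. A n)"
proof (cases "\<exists>n. A n = {}")
  case True
  then have "(\<Inter>n. A n) = {}" by blast
  then show ?thesis by (simp add: analytic_set_empty)
next
  case False
  then have "\<exists>h :: (nat \<Rightarrow> nat) \<Rightarrow> nat \<Rightarrow> 'a. continuous_on UNIV h \<and> range h = A n" for n
    using analytic_set_range[OF assms] by simp
  then obtain h :: "nat \<Rightarrow> (nat \<Rightarrow> nat) \<Rightarrow> nat \<Rightarrow> 'a"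
    where h: "\<And>n. continuous_on UNIV (h n)" "\<And>n. range (h n) = A n"
    by metis
  have hr: "continuous_on UNIV (\<lambda>u. h n (track u n))" for n
    by (rule continuous_on_track[OF h(1)])
  define C where "C = {u. \<forall>n. h n (track u n) = h 0 (track u 0)}"
  have "closed {u. h n (track u n) i = h 0 (track u 0) i}" for n i
    by (rule closed_Collect_eq; rule continuous_on_product_then_coordinatewise[OF hr])
  moreover have "C = (\<Inter>n. \<Inter>i. {u. h n (track u n) i = h 0 (track u 0) i})"
    unfolding C_def fun_eq_iff by blast
  ultimately have "closed C" by (simp add: closed_INT)
  moreover have "continuous_on C (\<lambda>u. h 0 (track u 0))"
    using hr continuous_on_subset by blast
  ultimately have "analytic_set ((\<lambda>u. h 0 (track u 0)) ` C)" by (rule analytic_setI)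
  also have "(\<lambda>u. h 0 (track u 0)) ` C = (\<Inter>n. A n)"
  proof
    show "(\<lambda>u. h 0 (track u 0)) ` C \<subseteq> (\<Inter>n. A n)"
      using h(2) by (auto simp: C_def, metis rangeI)
    show "(\<Inter>n. A n) \<subseteq> (\<lambda>u. h 0 (track u 0)) ` C"
    proof
      fix x assume "x \<in> (\<Inter>n. A n)"
      then have "x \<in> range (h n)" for n using h(2) by simp
      then have "\<forall>n. \<exists>w. h n w = x" by (simp add: image_iff) metis
      then obtain w where "\<And>n. h n (w n) = x" using choice[of "\<lambda>n w. h n w = x"] by blast
      then show "x \<in> (\<lambda>u. h 0 (track u 0)) ` C"
        by (auto intro!: image_eqI[of _ _ "interleave w"] simp: C_def)
    qed
  qed
  finally show ?thesis .
qed

text \<open>In the Baire space open sets are countable unions of closed sets, so the analytic sets with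
  analytic complement form a \<open>\<sigma>\<close>-algebra that contains the open sets.\<close>
lemma borel_analytic_set_baire:
  fixes A :: "(nat \<Rightarrow> nat) set"
  assumes "A \<in> sets borel"
  shows "analytic_set A"
proof -
  have cl: "analytic_set U" if "closed U" for U :: "(nat \<Rightarrow> nat) set"
    using analytic_setI[OF that continuous_on_id] by simp
  have op: "analytic_set U" if U: "open U" for U :: "(nat \<Rightarrow> nat) set"
  proof -
    have ccyl: "closed (\<Union>u\<in>S. cyl u n)" for S :: "(nat \<Rightarrow> nat) set" and n
    proof -
      have "- (\<Union>u\<in>S. cyl u n) = (\<Union>v\<in>- (\<Union>u\<in>S. cyl u n). cyl v n)"
        unfolding cyl_def by (auto, metis)
      also have "open \<dots>" by (intro open_UN ballI open_cyl)
      finally show ?thesis by (simp add: closed_def)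
    qed
    have "U = (\<Union>n. \<Union>u\<in>{u. cyl u n \<subseteq> U}. cyl u n)"
    proof
      show "U \<subseteq> (\<Union>n. \<Union>u\<in>{u. cyl u n \<subseteq> U}. cyl u n)"
      proof
        fix u assume "u \<in> U"
        then obtain n where "cyl u n \<subseteq> U" using open_contains_cyl[OF U] by blast
        then show "u \<in> (\<Union>n. \<Union>u\<in>{u. cyl u n \<subseteq> U}. cyl u n)" using cyl_self by blast
      qed
    qed blast
    also have "analytic_set \<dots>" by (intro analytic_set_UN cl ccyl)
    finally show ?thesis .
  qed
  have "A \<in> sigma_sets UNIV {S. open S}" using assms by (simp add: borel_def)
  then have "analytic_set A \<and> analytic_set (- A)"
  proof induction
    case (Basic a)
    then show ?case using op cl by (simp add: closed_Compl)
  next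
    case Empty
    then show ?case using cl[of UNIV] by (simp add: analytic_set_empty)
  next
    case (Compl a)
    then show ?case by (simp add: Compl_eq_Diff_UNIV[symmetric])
  next
    case (Union a)
    have "analytic_set (\<Union>i. a i)" by (rule analytic_set_UN) (simp add: Union)
    moreover have "analytic_set (\<Inter>i. - a i)" by (rule analytic_set_INT) (simp add: Union)
    ultimately show ?case by (simp add: Compl_UN)
  qed
  then show ?thesis by blast
qed

text \<open>A point is coded by a sequence from a countable dense set in which consecutive distances
  decrease geometrically.\<close>
lemma analytic_set_UNIV: "analytic_set (UNIV :: 'a::polish_space set)"
proof -
  obtain D :: "'a set" where D: "countable D" "\<And>U. open U \<Longrightarrow> U \<noteq> {} \<Longrightarrow> \<exists>d\<in>D. d \<in> U"
    by (rule countable_dense_setE) blast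
  have "D \<noteq> {}" using D(2)[of UNIV] by auto
  then obtain d :: "nat \<Rightarrow> 'a" where d: "range d = D" using D(1) uncountable_def by metis
  define C where "C = {w. \<forall>n. dist (d (w n)) (d (w (Suc n))) \<le> (1/2)^n}"
  define g where "g w = lim (\<lambda>n. d (w n))" for w
  have "closed {w :: nat \<Rightarrow> nat. dist (d (w n)) (d (w (Suc n))) \<le> (1/2)^n}" for n
  proof -
    have c: "continuous_on UNIV (\<lambda>w. d (w i))" for i
      by (rule continuous_on_compose2[OF _ continuous_on_product_coordinates, of UNIV])
        (auto intro: continuous_on_discrete)
    show ?thesis by (intro closed_Collect_le continuous_on_dist c continuous_on_const)
  qed
  moreover have "C = (\<Inter>n. {w. dist (d (w n)) (d (w (Suc n))) \<le> (1/2)^n})" by (auto simp: C_def)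
  ultimately have "closed C" by (simp add: closed_INT)
  have step: "dist (d (w n)) (d (w (n + k))) \<le> 2 * (1/2)^n - 2 * (1/2)^(n+k)" if "w \<in> C" for w n k
  proof (induction k)
    case (Suc k)
    have "dist (d (w n)) (d (w (n + Suc k))) \<le> dist (d (w n)) (d (w (n + k))) + dist (d (w (n+k))) (d (w (Suc (n+k))))"
      by (simp add: dist_triangle)
    also have "\<dots> \<le> 2 * (1/2)^n - 2 * (1/2)^(n+k) + (1/2)^(n+k)"
      using Suc that by (intro add_mono) (auto simp: C_def)
    finally show ?case by simp
  qed simp
  have bound: "dist (d (w n)) (d (w m)) \<le> 2 * (1/2)^n" if w: "w \<in> C" and m: "n \<le> m" for w n m
  proof -
    obtain k where "m = n + k" using m le_Suc_ex by blast
    have "0 \<le> 2 * (1/2::real)^(n+k)" by simp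
    then show ?thesis unfolding \<open>m = n + k\<close> using step[OF w, of n k] by linarith
  qed
  have tends: "(\<lambda>n. 2 * (1/2::real)^n) \<longlonglongrightarrow> 0"
    by (intro tendsto_mult_right_zero LIMSEQ_realpow_zero) auto
  have small: "\<exists>n. 2 * (1/2::real)^n < e" if "e > 0" for e
    using order_tendstoD(2)[OF tends that] by (auto dest: eventually_happens)
  have limg: "(\<lambda>n. d (w n)) \<longlonglongrightarrow> g w" if w: "w \<in> C" for w
  proof -
    have "Cauchy (\<lambda>n. d (w n))"
    proof (rule metric_CauchyI)
      fix e :: real assume "e > 0"
      then obtain N where N: "2 * (1/2::real)^N < e/2" using small[of "e/2"] by auto
      have "dist (d (w m)) (d (w n)) < e" if "m \<ge> N" "n \<ge> N" for m n
        using bound[OF w that(1)] bound[OF w that(2)] N dist_triangle3[of "d (w m)" "d (w n)" "d (w N)"] by linarith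
      then show "\<exists>M. \<forall>m\<ge>M. \<forall>n\<ge>M. dist (d (w m)) (d (w n)) < e" by blast
    qed
    then show ?thesis unfolding g_def using Cauchy_convergent convergent_LIMSEQ_iff by blast
  qed
  have gb: "dist (d (w n)) (g w) \<le> 2 * (1/2)^n" if "w \<in> C" for w n
    by (rule Lim_bounded[OF tendsto_dist[OF tendsto_const limg[OF that]]]) (use bound[OF that] in blast)
  have "continuous_on C g"
  proof (rule continuous_on_cylI)
    fix u V assume "open V" "u \<in> C" "g u \<in> V"
    then obtain e where e: "e > 0" "ball (g u) e \<subseteq> V" by (meson open_contains_ball)
    obtain N where N: "2 * (1/2::real)^N < e/2" using small[of "e/2"] e by auto
    have "g v \<in> V" if "v \<in> cyl u (Suc N) \<inter> C" for v
    proof -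
      have "v N = u N" "v \<in> C" using that by (auto simp: cyl_def)
      then have "dist (g u) (g v) < e"
        using gb[OF \<open>u \<in> C\<close>, of N] gb[of v N] N dist_triangle3[of "g u" "g v" "d (u N)"] by auto
      then show ?thesis using e by auto
    qed
    then show "\<exists>n. \<forall>v\<in>cyl u n \<inter> C. g v \<in> V" by blast
  qed
  moreover have "x \<in> g ` C" for x
  proof -
    have "\<exists>k. dist (d k) x < (1/2)^Suc n" for n
    proof -
      have "ball x ((1/2)^Suc n) \<noteq> {}" by (simp add: not_le)
      from D(2)[OF open_ball this] d show ?thesis by (auto simp: dist_commute)
    qed
    then obtain w where w: "\<And>n. dist (d (w n)) x < (1/2)^Suc n" by metis
    have "w \<in> C" unfolding C_def
    proof (intro CollectI allI)
      fix n
      have "dist (d (w n)) (d (w (Suc n))) \<le> (1/2)^Suc n + (1/2)^Suc (Suc n)"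
        using w[of n] w[of "Suc n"] dist_triangle2[of "d (w n)" "d (w (Suc n))" x] by linarith
      also have "\<dots> \<le> (1/2)^n" by simp
      finally show "dist (d (w n)) (d (w (Suc n))) \<le> (1/2)^n" .
    qed
    moreover have "(\<lambda>n. d (w n)) \<longlonglongrightarrow> x"
    proof (rule metric_tendsto_imp_tendsto[OF tends], rule always_eventually, rule allI)
      fix n
      have "dist (d (w n)) x \<le> 2 * (1/2)^n"
        using w[of n] zero_le_dist[of "d (w n)" x] by (simp only: power_Suc)
      then show "dist (d (w n)) x \<le> dist (2 * (1/2)^n) (0::real)" by simp
    qed
    ultimately show ?thesis using limg LIMSEQ_unique by blast
  qed
  ultimately show ?thesis unfolding analytic_set_def using \<open>closed C\<close> by blast
qed

text \<open>Pull the set back along a continuous surjection from the Baire space.\<close>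
lemma borel_analytic_set:
  fixes A :: "'a::polish_space set"
  assumes "A \<in> sets borel"
  shows "analytic_set A"
proof -
  obtain g :: "(nat \<Rightarrow> nat) \<Rightarrow> 'a" where g: "continuous_on UNIV g" "range g = UNIV"
    using analytic_set_range[OF analytic_set_UNIV] by blast
  have "g -` A \<in> sets borel"
    using measurable_sets[OF borel_measurable_continuous_onI[OF g(1)] assms] by simp
  then have "analytic_set (g ` (g -` A))"
    using g(1) by (intro analytic_set_image borel_analytic_set_baire) (auto intro: continuous_on_subset)
  then show ?thesis using g(2) by (simp add: image_vimage_eq)
qed

section \<open>Separation for coverings by rectangles\<close>

text \<open>A form of Novikov's separation theorem, for coverings by rectangles \<open>U k \<times> - H k\<close> whose first factors
  are kept. If there were no such Borel sets, one could refine all the parametrizations of \<open>Q\<close> and of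
  the \<open>H k\<close> together while preserving inseparability.
  Splitting \<open>Q\<close> into countably many parts is harmless, as the Borel sets obtained for the parts can be
  intersected. Splitting one \<open>H j\<close> is harmless too, if the Borel sets are united at the index \<open>j\<close> and
  intersected elsewhere. In the limit there remain a point \<open>(x, y)\<close> of \<open>Q\<close> and one point in each
  \<open>H k\<close>, and for a \<open>k\<close> with \<open>(x, y) \<in> U k \<times> - H k\<close> disjoint neighbourhoods of \<open>y\<close> and of the point in \<open>H k\<close>
  separate, which is a contradiction.\<close>
lemma cover_separation:
  fixes Q :: "('a::topological_space \<times> 'b::t2_space) set" and H :: "nat \<Rightarrow> 'b set"
  assumes Q: "analytic_set Q" and H: "\<And>k. analytic_set (H k)" and U: "\<And>k. open (U k)"
    and cover: "\<And>x y. (x, y) \<in> Q \<Longrightarrow> \<exists>k. x \<in> U k \<and> y \<notin> H k"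
  shows "\<exists>B. (\<forall>k. B k \<in> sets borel \<and> H k \<subseteq> B k) \<and> (\<forall>x y. (x, y) \<in> Q \<longrightarrow> (\<exists>k. x \<in> U k \<and> y \<notin> B k))"
proof (cases "Q = {}")
  case True
  then show ?thesis by (intro exI[of _ "\<lambda>_. UNIV"]) auto
next
  case False
  then obtain p :: "(nat \<Rightarrow> nat) \<Rightarrow> 'a \<times> 'b" where p: "continuous_on UNIV p" "range p = Q"
    using analytic_set_range[OF Q] by blast
  have "\<exists>h :: (nat \<Rightarrow> nat) \<Rightarrow> 'b. continuous_on UNIV h \<and> (H k \<noteq> {} \<longrightarrow> range h = H k)" for k
  proof (cases "H k = {}")
    case True
    then show ?thesis by (intro exI[of _ "\<lambda>_. undefined"]) simp
  next
    case False
    then show ?thesis using analytic_set_range[OF H False] by simp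
  qed
  then obtain h :: "nat \<Rightarrow> (nat \<Rightarrow> nat) \<Rightarrow> 'b"
    where h: "\<And>k. continuous_on UNIV (h k)" "\<And>k. H k \<noteq> {} \<Longrightarrow> range (h k) = H k"
    by metis
  define sep where "sep R K \<longleftrightarrow> (\<exists>B. (\<forall>k. B k \<in> sets borel \<and> K k \<subseteq> B k) \<and>
      (\<forall>x y. (x, y) \<in> R \<longrightarrow> (\<exists>k. x \<in> U k \<and> y \<notin> B k)))" for R and K :: "nat \<Rightarrow> 'b set"
  define PQ where "PQ S = p ` (\<lambda>v. track v 0) ` S" for S
  define PH where "PH S k = (if H k = {} then {} else h k ` (\<lambda>v. track v (Suc k)) ` S)" for S k
  have track_surj: "range (\<lambda>v. track v i) = UNIV" for i
    by (rule surjI[of _ "\<lambda>w. interleave (\<lambda>_. w)"]) simp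
  have PQ_UNIV: "PQ UNIV = Q" by (simp add: PQ_def track_surj p(2))
  have PH_UNIV: "PH UNIV = H" by (auto simp: PH_def track_surj h(2) fun_eq_iff)
  have "sep Q H"
  proof (rule ccontr)
    assume "\<not> sep Q H"
    have "\<exists>u. \<forall>n. \<not> sep (PQ (cyl u n)) (PH (cyl u n))"
    proof (rule cyl_branch[of "\<lambda>n S. \<not> sep (PQ S) (PH S)"])
      show "\<not> sep (PQ UNIV) (PH UNIV)" using \<open>\<not> sep Q H\<close> by (simp add: PQ_UNIV PH_UNIV)
    next
      fix n u assume ns: "\<not> sep (PQ (cyl u n)) (PH (cyl u n))"
      define S where "S c = cyl (u(n := c)) (Suc n)" for c
      show "\<exists>v\<in>cyl u n. \<not> sep (PQ (cyl v (Suc n))) (PH (cyl v (Suc n)))"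
      proof (rule ccontr)
        assume "\<not> ?thesis"
        moreover have "u(n := c) \<in> cyl u n" for c by (simp add: cyl_def)
        ultimately have "sep (PQ (S c)) (PH (S c))" for c unfolding S_def by blast
        then have "\<forall>c. \<exists>B. (\<forall>k. B k \<in> sets borel \<and> PH (S c) k \<subseteq> B k) \<and>
            (\<forall>x y. (x, y) \<in> PQ (S c) \<longrightarrow> (\<exists>k. x \<in> U k \<and> y \<notin> B k))" unfolding sep_def by blast
        from choice[OF this] obtain B where B: "\<And>c k. B c k \<in> sets borel" "\<And>c k. PH (S c) k \<subseteq> B c k"
            "\<And>c x y. (x, y) \<in> PQ (S c) \<Longrightarrow> \<exists>k. x \<in> U k \<and> y \<notin> B c k"
          by blast
        have S: "cyl u n = (\<Union>c. S c)" unfolding S_def by (rule cyl_split)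
        have PHU: "PH (cyl u n) k = (\<Union>c. PH (S c) k)" for k
          unfolding S by (auto simp: PH_def)
        have PQU: "PQ (cyl u n) = (\<Union>c. PQ (S c))"
          unfolding S by (auto simp: PQ_def)
        have PHeq: "PH (cyl u n) k = PH (S c) k" if "Suc k \<noteq> fst (prod_decode n)" for k c
          unfolding PH_def S_def track_cyl_split[OF that, of u c] ..
        have PQeq: "PQ (cyl u n) = PQ (S c)" if "0 \<noteq> fst (prod_decode n)" for c
          unfolding PQ_def S_def track_cyl_split[OF that, of u c] ..
        \<comment> \<open>The value \<open>0\<close> of \<open>fst (prod_decode n)\<close> stands for \<open>Q\<close>, so then no union occurs.\<close>
        define B' where "B' k = (if Suc k = fst (prod_decode n) then \<Union>c. B c k else \<Inter>c. B c k)" for k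
        have "B' k \<in> sets borel" for k
          using B(1) by (auto simp: B'_def)
        moreover have "PH (cyl u n) k \<subseteq> B' k" for k
        proof (cases "Suc k = fst (prod_decode n)")
          case True
          then show ?thesis using B(2) unfolding PHU by (auto simp: B'_def)
        next
          case False
          then show ?thesis using B(2)[of _ k] PHeq[OF False] by (auto simp: B'_def)
        qed
        moreover have "\<exists>k. x \<in> U k \<and> y \<notin> B' k" if xy: "(x, y) \<in> PQ (cyl u n)" for x y
        proof (cases "fst (prod_decode n)")
          case 0
          obtain c where "(x, y) \<in> PQ (S c)" using xy unfolding PQU by blast
          then obtain k where "x \<in> U k" "y \<notin> B c k" using B(3) by blast
          then show ?thesis using 0 by (intro exI[of _ k]) (auto simp: B'_def)
        next
          case (Suc j)
          then have "(x, y) \<in> PQ (S c)" for c using xy PQeq by simp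
          then have *: "\<exists>k. x \<in> U k \<and> y \<notin> B c k" for c using B(3) by blast
          show ?thesis
          proof (cases "\<exists>c k. k \<noteq> j \<and> x \<in> U k \<and> y \<notin> B c k")
            case True
            then obtain c k where "k \<noteq> j" "x \<in> U k" "y \<notin> B c k" by blast
            then show ?thesis using Suc by (intro exI[of _ k]) (auto simp: B'_def)
          next
            case False
            then have "x \<in> U j \<and> y \<notin> B c j" for c using *[of c] by metis
            then show ?thesis using Suc by (intro exI[of _ j]) (auto simp: B'_def)
          qed
        qed
        ultimately have "sep (PQ (cyl u n)) (PH (cyl u n))" unfolding sep_def by blast
        with ns show False by blast
      qed
    qed
    then obtain u where u: "\<And>n. \<not> sep (PQ (cyl u n)) (PH (cyl u n))" by blast
    obtain x y where xy: "p (track u 0) = (x, y)" by fastforce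
    then have "(x, y) \<in> Q" using p(2) by (metis rangeI)
    then obtain k where k: "x \<in> U k" "y \<notin> H k" using cover by blast
    \<comment> \<open>For empty \<open>H k\<close> there is no point to be separated from \<open>y\<close>, and \<open>V'\<close> can be empty.\<close>
    have "\<exists>V V'. open V \<and> open V' \<and> y \<in> V \<and> V \<inter> V' = {} \<and> (H k \<noteq> {} \<longrightarrow> h k (track u (Suc k)) \<in> V')"
    proof (cases "H k = {}")
      case True
      then show ?thesis by (intro exI[of _ UNIV] exI[of _ "{}"]) auto
    next
      case False
      then have "h k (track u (Suc k)) \<noteq> y" using h(2) k(2) by blast
      then show ?thesis using hausdorff by metis
    qed
    then obtain V V' where V: "open V" "open V'" "y \<in> V" "V \<inter> V' = {}"
      "H k \<noteq> {} \<Longrightarrow> h k (track u (Suc k)) \<in> V'" by blast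
    have "open (U k \<times> V)" using U V(1) by (simp add: open_Times)
    then have "\<exists>n1. \<forall>v\<in>cyl u n1. p (track v 0) \<in> U k \<times> V"
      by (rule continuous_cylD[OF continuous_on_track[OF p(1)]]) (simp add: xy k(1) V(3))
    then obtain n1 where n1: "\<forall>v\<in>cyl u n1. p (track v 0) \<in> U k \<times> V" by blast
    have "\<exists>n2. \<forall>v\<in>cyl u n2. H k \<noteq> {} \<longrightarrow> h k (track v (Suc k)) \<in> V'"
    proof (cases "H k = {}")
      case False
      have "\<exists>n2. \<forall>v\<in>cyl u n2. h k (track v (Suc k)) \<in> V'"
        using continuous_cylD[OF continuous_on_track[of "h k" "Suc k", OF h(1)] V(2)] V(5)[OF False] .
      then show ?thesis by blast
    qed simp
    then obtain n2 where n2: "\<forall>v\<in>cyl u n2. H k \<noteq> {} \<longrightarrow> h k (track v (Suc k)) \<in> V'" by blast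
    define n where "n = max n1 n2"
    have n: "cyl u n \<subseteq> cyl u n1" "cyl u n \<subseteq> cyl u n2" unfolding n_def by (intro cyl_mono; simp)+
    define B where "B j = (if j = k then V' else UNIV)" for j
    have "B j \<in> sets borel" for j using V(2) by (simp add: B_def)
    moreover have "PH (cyl u n) j \<subseteq> B j" for j
      using n2 n(2) by (auto simp: PH_def B_def)
    moreover have "\<exists>k. x \<in> U k \<and> y \<notin> B k" if xyn: "(x, y) \<in> PQ (cyl u n)" for x y
    proof -
      obtain v where v: "v \<in> cyl u n" "(x, y) = p (track v 0)"
        using xyn unfolding PQ_def by blast
      have "v \<in> cyl u n1" by (rule subsetD[OF n(1) v(1)])
      then have "(x, y) \<in> U k \<times> V" unfolding v(2) by (rule n1[rule_format])
      then show ?thesis using V(4) by (intro exI[of _ k]) (auto simp: B_def)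
    qed
    ultimately have "sep (PQ (cyl u n)) (PH (cyl u n))" unfolding sep_def by blast
    with u show False by blast
  qed
  then show ?thesis unfolding sep_def .
qed

section \<open>Sets with closed fibres\<close>

definition closed_fibred :: "('a::topological_space \<Rightarrow> 'b) \<Rightarrow> 'a set \<Rightarrow> bool" where
  "closed_fibred f C \<longleftrightarrow> C \<in> sets borel \<and> (\<forall>y. closed (C \<inter> f -` {y}))"

text \<open>The covering hypothesis makes the intersection with the fibre over \<open>y\<close> the complement of the union
  of all \<open>U k\<close> with \<open>y \<notin> B k\<close>: this union contains every point outside the fibre.\<close>
lemma closed_fibred_cover:
  fixes f :: "'a::topological_space \<Rightarrow> 'b::topological_space"
  assumes f: "f \<in> borel_measurable borel" and U: "\<And>k::nat. open (U k)" and B: "\<And>k. B k \<in> sets borel"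
    and cover: "\<And>x y. f x \<noteq> y \<Longrightarrow> \<exists>k. x \<in> U k \<and> y \<notin> B k"
  shows "closed_fibred f {x. \<forall>k. x \<in> U k \<longrightarrow> f x \<in> B k}"
  unfolding closed_fibred_def
proof (intro conjI allI)
  have "{x. \<forall>k. x \<in> U k \<longrightarrow> f x \<in> B k} = (\<Inter>k. - U k \<union> f -` B k)" by auto
  also have "\<dots> \<in> sets borel"
  proof -
    have "f -` B k \<in> sets borel" for k using measurable_sets[OF f B] by simp
    moreover have "- U k \<in> sets borel" for k using U by (intro borel_closed closed_Compl)
    ultimately show ?thesis by (intro sets.countable_INT'' sets.Un) auto
  qed
  finally show "{x. \<forall>k. x \<in> U k \<longrightarrow> f x \<in> B k} \<in> sets borel" .
next
  fix y
  have "{x. \<forall>k. x \<in> U k \<longrightarrow> f x \<in> B k} \<inter> f -` {y} = - (\<Union>k\<in>{k. y \<notin> B k}. U k)"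
  proof
    show "{x. \<forall>k. x \<in> U k \<longrightarrow> f x \<in> B k} \<inter> f -` {y} \<subseteq> - (\<Union>k\<in>{k. y \<notin> B k}. U k)" by auto
    show "- (\<Union>k\<in>{k. y \<notin> B k}. U k) \<subseteq> {x. \<forall>k. x \<in> U k \<longrightarrow> f x \<in> B k} \<inter> f -` {y}"
    proof
      fix x assume x: "x \<in> - (\<Union>k\<in>{k. y \<notin> B k}. U k)"
      then have "f x = y" using cover[of x y] by blast
      with x show "x \<in> {x. \<forall>k. x \<in> U k \<longrightarrow> f x \<in> B k} \<inter> f -` {y}" by auto
    qed
  qed
  moreover have "open (\<Union>k\<in>{k. y \<notin> B k}. U k)" using U by auto
  ultimately show "closed ({x. \<forall>k. x \<in> U k \<longrightarrow> f x \<in> B k} \<inter> f -` {y})" by (simp add: closed_def)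
qed

definition small :: "('a::topological_space \<Rightarrow> 'b) \<Rightarrow> 'a set \<Rightarrow> bool" where
  "small f B \<longleftrightarrow> (\<exists>\<C>. countable \<C> \<and> (\<forall>C\<in>\<C>. closed_fibred f C) \<and> B = \<Union>\<C>)"

lemma small_UN:
  assumes "countable I" "\<And>i. i \<in> I \<Longrightarrow> small f (B i)"
  shows "small f (\<Union>i\<in>I. B i)"
proof -
  obtain \<C> where "\<And>i. i \<in> I \<Longrightarrow> countable (\<C> i) \<and> (\<forall>C\<in>\<C> i. closed_fibred f C) \<and> B i = \<Union>(\<C> i)"
    using assms(2) unfolding small_def by metis
  then show ?thesis
    using assms(1) unfolding small_def by (intro exI[of _ "\<Union>i\<in>I. \<C> i"]) auto
qed

lemma small_Un: "small f A \<Longrightarrow> small f B \<Longrightarrow> small f (A \<union> B)"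
  using small_UN[of "UNIV :: bool set" f "\<lambda>b. if b then A else B"] by (simp add: UNIV_bool Un_commute)

lemma closed_fibred_small: "closed_fibred f C \<Longrightarrow> small f C"
  unfolding small_def by (intro exI[of _ "{C}"]) auto

lemma small_borel: "small f B \<Longrightarrow> B \<in> sets borel"
  unfolding small_def closed_fibred_def by (auto intro: sets.countable_Union)

section \<open>Configurations in a fibre\<close>

text \<open>A sequence \<open>u\<close> represents a configuration by its tracks. The even tracks \<open>inner u i\<close> are codes of
  points of one fibre, and the odd tracks \<open>outer u j\<close> are codes of pairs \<open>(x, y)\<close> with \<open>f x \<noteq> y\<close>. The
  \<open>j\<close>-th pair supplies the limit \<open>x\<close> of the points with the indices \<open>child j k\<close>, whose codes are to be near
  the code with the index \<open>parent j\<close>. Each index is the parent of arbitrarily large \<open>j\<close>, since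
  \<open>parent (prod_encode (i, N)) = i\<close>, and the children of \<open>j\<close> have indices above \<open>j\<close>, hence also above its
  parent.\<close>
abbreviation child :: "nat \<Rightarrow> nat \<Rightarrow> nat" where "child j k \<equiv> Suc (prod_encode (j, k))"

abbreviation parent :: "nat \<Rightarrow> nat" where "parent j \<equiv> fst (prod_decode j)"

abbreviation inner :: "(nat \<Rightarrow> nat) \<Rightarrow> nat \<Rightarrow> nat \<Rightarrow> nat" where "inner u i \<equiv> track u (2 * i)"

abbreviation outer :: "(nat \<Rightarrow> nat) \<Rightarrow> nat \<Rightarrow> nat \<Rightarrow> nat" where "outer u j \<equiv> track u (Suc (2 * j))"

lemma parent_le: "parent j \<le> j"
  using le_prod_encode_1[of "fst (prod_decode j)" "snd (prod_decode j)"] by simp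

lemma cyl_altdef: "v \<in> cyl u n \<longleftrightarrow> (\<forall>i l. prod_encode (i, l) < n \<longrightarrow> track v i l = track u i l)"
  unfolding cyl_def track_def by (auto, metis prod_decode_inverse surj_pair)

text \<open>The configurations that meet the demands of the first \<open>n\<close> outer points; \<open>\<phi>\<close> and \<open>\<psi>\<close> are the two
  components of a parametrization of the graph of \<open>f\<close>, and \<open>p\<close> parametrizes its complement. All the
  inner points lie in the same fibre, but the children of every \<open>j \<ge> n\<close> may still be exchanged.
  The children of \<open>j\<close> must share with their parent those entries that a cylinder of length \<open>j\<close> fixes; as
  \<open>j\<close> grows, this is any given initial segment.\<close>
definition configs :: "((nat \<Rightarrow> nat) \<Rightarrow> 'a::metric_space) \<Rightarrow> ((nat \<Rightarrow> nat) \<Rightarrow> 'b)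
    \<Rightarrow> ((nat \<Rightarrow> nat) \<Rightarrow> 'a \<times> 'b) \<Rightarrow> nat \<Rightarrow> (nat \<Rightarrow> nat) set" where
  "configs \<phi> \<psi> p n = {u. (\<forall>i. \<psi> (inner u i) = \<psi> (inner u 0)) \<and>
     (\<forall>j<n. snd (p (outer u j)) = \<psi> (inner u 0) \<and>
        (\<forall>k. dist (\<phi> (inner u (child j k))) (fst (p (outer u j))) \<le> 1 / Suc k) \<and>
        (\<forall>k l. prod_encode (2 * parent j, l) < j \<longrightarrow> inner u (child j k) l = inner u (parent j) l))}"

lemma configs_antimono: "m \<le> n \<Longrightarrow> configs \<phi> \<psi> p n \<subseteq> configs \<phi> \<psi> p m"
  by (auto simp: configs_def)

lemma closed_configs:
  fixes \<psi> :: "(nat \<Rightarrow> nat) \<Rightarrow> 'b::t2_space"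
  assumes "continuous_on UNIV \<phi>" "continuous_on UNIV \<psi>" "continuous_on UNIV p"
  shows "closed (configs \<phi> \<psi> p n)"
proof -
  have l: "continuous_on UNIV (\<lambda>v :: nat \<Rightarrow> nat. track v i l)" for i l
    unfolding track_def by (rule continuous_on_product_coordinates)
  have p: "continuous_on UNIV (\<lambda>u. fst (p (outer u j)))" "continuous_on UNIV (\<lambda>u. snd (p (outer u j)))" for j
    by (intro continuous_on_fst continuous_on_snd continuous_on_track[of p, OF assms(3)])+
  have "configs \<phi> \<psi> p n = (\<Inter>i. {u. \<psi> (inner u i) = \<psi> (inner u 0)}) \<inter>
      (\<Inter>j\<in>{..<n}. {u. snd (p (outer u j)) = \<psi> (inner u 0)} \<inter>
        (\<Inter>k. {u. dist (\<phi> (inner u (child j k))) (fst (p (outer u j))) \<le> 1 / Suc k}) \<inter>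
        (\<Inter>k. \<Inter>l\<in>{l. prod_encode (2 * parent j, l) < j}. {u. inner u (child j k) l = inner u (parent j) l}))"
    unfolding configs_def by blast
  moreover have "closed {u. \<psi> (inner u i) = \<psi> (inner u 0)}" for i
    by (intro closed_Collect_eq continuous_on_track[of \<psi>, OF assms(2)])
  moreover have "closed {u. snd (p (outer u j)) = \<psi> (inner u 0)}" for j
    by (intro closed_Collect_eq p continuous_on_track[of \<psi>, OF assms(2)])
  moreover have "closed {u. dist (\<phi> (inner u (child j k))) (fst (p (outer u j))) \<le> 1 / Suc k}" for j k
    by (intro closed_Collect_le continuous_on_dist p continuous_on_track[of \<phi>, OF assms(1)] continuous_on_const)
  moreover have "closed {u :: nat \<Rightarrow> nat. inner u (child j k) l = inner u (parent j) l}" for j k l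
    by (intro closed_Collect_eq l)
  ultimately show ?thesis by (simp add: closed_INT closed_Int)
qed

text \<open>The points \<open>inner (v k) (parent n)\<close> become the children of \<open>n\<close>. Their tracks, and that of the new outer
  point, have indices above \<open>n\<close>, so neither the cylinder nor the first \<open>n\<close> demands see the change.
  The new children agree with their parent where required, because all the configurations involved lie
  in one cylinder of length \<open>n\<close>.\<close>
lemma configs_extend:
  assumes u: "u \<in> configs \<phi> \<psi> p n"
    and v: "\<And>k. v k \<in> cyl u n"
    and \<psi>v: "\<And>k. \<psi> (inner (v k) (parent n)) = \<psi> (inner u 0)"
    and q: "snd (p q) = \<psi> (inner u 0)" "\<And>k. dist (\<phi> (inner (v k) (parent n))) (fst (p q)) \<le> 1 / Suc k"
  shows "\<exists>u'\<in>configs \<phi> \<psi> p (Suc n) \<inter> cyl u n. \<forall>i. inner u' i = inner u i \<or> (\<exists>k. inner u' i = inner (v k) (parent n))"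
proof -
  define w where "w i = (if i \<noteq> 0 \<and> parent (i - 1) = n then inner (v (snd (prod_decode (i - 1)))) (parent n) else inner u i)" for i
  define x where "x j = (if j = n then q else outer u j)" for j
  define u' where "u' = interleave (\<lambda>m. if even m then w (m div 2) else x (m div 2))"
  have inner_u': "inner u' i = w i" and outer_u': "outer u' j = x j" for i j by (simp_all add: u'_def)
  have w_child: "w (child n k) = inner (v k) (parent n)" for k by (simp add: w_def)
  have w_other: "w (child j k) = inner u (child j k)" if "j \<noteq> n" for j k using that by (simp add: w_def)
  have w_low: "w i = inner u i" if "i \<le> n" for i
    using that parent_le[of "i - 1"] by (auto simp: w_def)
  have "inner u' i = inner u i \<or> (\<exists>k. inner u' i = inner (v k) (parent n))" for i
    unfolding inner_u' w_def by auto
  moreover have "u' \<in> cyl u n"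
    unfolding cyl_altdef
  proof (intro allI impI)
    fix i l assume "prod_encode (i, l) < n"
    then have i: "i < n" using le_prod_encode_1[of i l] by simp
    show "track u' i l = track u i l"
    proof (cases "even i")
      case True
      then obtain m where m: "i = 2 * m" by blast
      then show ?thesis using inner_u'[of m] w_low[of m] i by simp
    next
      case False
      then obtain m where m: "i = Suc (2 * m)" by (metis oddE Suc_eq_plus1)
      then show ?thesis using outer_u'[of m] i by (simp add: x_def)
    qed
  qed
  moreover have "u' \<in> configs \<phi> \<psi> p (Suc n)"
  proof -
    have w0: "w 0 = inner u 0" by (simp add: w_def)
    have "\<psi> (w i) = \<psi> (w 0)" for i
      unfolding w0 using u \<psi>v by (auto simp: w_def configs_def)
    moreover have "snd (p (x j)) = \<psi> (w 0)" if "j < Suc n" for j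
      using that u q(1) by (cases "j = n") (auto simp: x_def w0 configs_def)
    moreover have "dist (\<phi> (w (child j k))) (fst (p (x j))) \<le> 1 / Suc k" if "j < Suc n" for j k
    proof (cases "j = n")
      case True
      then show ?thesis using q(2) by (simp add: x_def w_child)
    next
      case False
      then have "j < n" using that by simp
      with False show ?thesis using u unfolding w_other[OF False] by (simp add: x_def configs_def)
    qed
    moreover have "w (child j k) l = w (parent j) l"
      if j: "j < Suc n" and l: "prod_encode (2 * parent j, l) < j" for j k l
    proof -
      have "parent j \<le> n" using parent_le[of j] j by simp
      note low = w_low[OF this]
      show ?thesis
      proof (cases "j = n")
        case True
        then show ?thesis using v[of k] l unfolding low by (simp add: w_child cyl_altdef)
      next
        case False
        then have "j < n" using j by simp
        then show ?thesis using u l unfolding low w_other[OF False] by (simp add: configs_def)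
      qed
    qed
    ultimately show ?thesis unfolding configs_def mem_Collect_eq inner_u' outer_u' by blast
  qed
  ultimately show ?thesis by blast
qed

text \<open>Positivity with respect to the \<open>\<sigma>\<close>-ideal generated by the sets of configurations that have an inner
  point in a given small set.\<close>
definition large where
  "large f \<phi> \<psi> p n S \<longleftrightarrow> (\<forall>B. small f B \<longrightarrow> (\<exists>u\<in>configs \<phi> \<psi> p n \<inter> S. \<forall>i. \<phi> (inner u i) \<notin> B))"

text \<open>Small sets are closed under countable unions.\<close>
lemma large_split:
  assumes "large f \<phi> \<psi> p n (cyl u m)"
  shows "\<exists>v\<in>cyl u m. large f \<phi> \<psi> p n (cyl v (Suc m))"
proof (rule ccontr)
  assume "\<not> ?thesis"
  moreover have "u(m := c) \<in> cyl u m" for c by (simp add: cyl_def)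
  ultimately have "\<forall>c. \<exists>B. small f B \<and> \<not> (\<exists>v\<in>configs \<phi> \<psi> p n \<inter> cyl (u(m := c)) (Suc m). \<forall>i. \<phi> (inner v i) \<notin> B)"
    unfolding large_def by blast
  from choice[OF this] obtain B where B: "\<And>c. small f (B c)"
    "\<And>c v. v \<in> configs \<phi> \<psi> p n \<Longrightarrow> v \<in> cyl (u(m := c)) (Suc m) \<Longrightarrow> \<exists>i. \<phi> (inner v i) \<in> B c"
    by blast
  have "small f (\<Union>c. B c)" using B(1) by (intro small_UN) auto
  then obtain v where v: "v \<in> configs \<phi> \<psi> p n" "v \<in> cyl u m" "\<And>i. \<phi> (inner v i) \<notin> (\<Union>c. B c)"
    using assms unfolding large_def by blast
  then obtain c where "v \<in> cyl (u(m := c)) (Suc m)" using cyl_split[of u m] by blast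
  with B(2)[OF v(1)] v(3) show False by blast
qed

text \<open>Consider the values at \<open>parent n\<close> of the configurations in the cylinder
  that avoid \<open>B\<close>. If for some \<open>(x, y)\<close> with \<open>f x \<noteq> y\<close> there were such values in the fibre over \<open>y\<close>
  arbitrarily near to \<open>x\<close>, then they could be made the children of a new outer point \<open>(x, y)\<close>.
  Otherwise separation provides a closed-fibred set that contains all these values, and adding it to \<open>B\<close>
  gives a small set that hits every configuration in the cylinder, against its largeness.\<close>
lemma large_extend:
  fixes f :: "'a::polish_space \<Rightarrow> 'b::polish_space"
  assumes f: "f \<in> borel_measurable borel"
    and cont: "continuous_on UNIV \<phi>" "continuous_on UNIV \<psi>" "continuous_on UNIV p"
    and \<psi>: "\<And>w. \<psi> w = f (\<phi> w)" and p: "range p = {(x, y). f x \<noteq> y}"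
    and large: "large f \<phi> \<psi> p n (cyl s n)"
  shows "large f \<phi> \<psi> p (Suc n) (cyl s n)"
  unfolding large_def
proof (intro allI impI, rule ccontr)
  fix B assume B: "small f B" and none: "\<not> (\<exists>u\<in>configs \<phi> \<psi> p (Suc n) \<inter> cyl s n. \<forall>i. \<phi> (inner u i) \<notin> B)"
  define M where "M = {u \<in> configs \<phi> \<psi> p n \<inter> cyl s n. \<forall>i. \<phi> (inner u i) \<notin> B}"
  define z where "z u = inner u (parent n)" for u
  obtain U :: "nat \<Rightarrow> 'a set" where U: "\<And>k. open (U k)" "\<And>x V. open V \<Longrightarrow> x \<in> V \<Longrightarrow> \<exists>k. x \<in> U k \<and> U k \<subseteq> V"
  proof -
    obtain \<B> :: "'a set set" where \<B>: "countable \<B>" "topological_basis \<B>"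
      using ex_countable_basis by blast
    then have "\<B> \<noteq> {}" by (metis UNIV_I empty_iff open_UNIV topological_basisE)
    then have "range (from_nat_into \<B>) = \<B>" using \<B>(1) by (simp add: range_from_nat_into)
    then show thesis
      using \<B>(2) by (intro that[of "from_nat_into \<B>"]) (metis rangeI topological_basis_open, metis rangeE topological_basisE)
  qed
  define H where "H k = (\<lambda>u. \<psi> (z u)) ` {u \<in> M. \<phi> (z u) \<in> U k}" for k
  have Mb: "{u \<in> M. \<phi> (z u) \<in> U k} \<in> sets borel" for k
  proof -
    have pre: "(\<lambda>u. \<phi> (inner u i)) -` C \<in> sets borel" if "C \<in> sets borel" for i C
      using measurable_sets[OF borel_measurable_continuous_onI[OF continuous_on_track[OF cont(1)]] that] by simp
    have "{u \<in> M. \<phi> (z u) \<in> U k} = configs \<phi> \<psi> p n \<inter> cyl s n \<inter> (\<Inter>i. - ((\<lambda>u. \<phi> (inner u i)) -` B)) \<inter> (\<lambda>u. \<phi> (inner u (parent n))) -` U k"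
      by (auto simp: M_def z_def)
    also have "\<dots> \<in> sets borel"
      using closed_configs[OF cont] open_cyl[of s n] U(1) small_borel[OF B] pre
      by (intro sets.Int sets.countable_INT'') (auto simp: borel_comp)
    finally show ?thesis .
  qed
  have "analytic_set (H k)" for k
    unfolding H_def z_def
    by (intro analytic_set_image borel_analytic_set_baire Mb[unfolded z_def]
        continuous_on_subset[OF continuous_on_track[OF cont(2)]] subset_UNIV)
  moreover have "analytic_set {(x, y). f x \<noteq> y}"
    unfolding p[symmetric] by (rule analytic_setI[OF closed_UNIV cont(3)])
  moreover have "\<exists>k. x \<in> U k \<and> y \<notin> H k" if xy: "(x, y) \<in> {(x, y). f x \<noteq> y}" for x y
  proof (rule ccontr)
    assume no: "\<not> ?thesis"
    have "\<exists>u\<in>M. dist (\<phi> (z u)) x \<le> 1 / Suc k \<and> \<psi> (z u) = y" for k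
    proof -
      obtain m where m: "x \<in> U m" "U m \<subseteq> ball x (1 / Suc k)"
        using U(2)[of "ball x (1 / Suc k)" x] by auto
      with no have "y \<in> H m" by blast
      then obtain u where u: "u \<in> M" "\<phi> (z u) \<in> U m" "\<psi> (z u) = y" by (auto simp: H_def)
      then have "\<phi> (z u) \<in> ball x (1 / Suc k)" using m(2) by blast
      with u show ?thesis by (intro bexI[of _ u]) (simp_all add: dist_commute)
    qed
    then obtain v where v: "\<And>k. v k \<in> M" "\<And>k. dist (\<phi> (z (v k))) x \<le> 1 / Suc k" "\<And>k. \<psi> (z (v k)) = y"
      by metis
    have "(x, y) \<in> range p" using xy p by simp
    then obtain q where q: "p q = (x, y)" by (metis rangeE)
    have s: "cyl (v 0) n = cyl s n" using v(1)[of 0] by (intro cyl_cong) (simp add: M_def)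
    have y: "\<psi> (inner (v 0) 0) = y"
      using v(1)[of 0] v(3)[of 0] by (simp add: M_def z_def configs_def)
    have "\<exists>u\<in>configs \<phi> \<psi> p (Suc n) \<inter> cyl (v 0) n. \<forall>i. inner u i = inner (v 0) i \<or> (\<exists>k. inner u i = inner (v k) (parent n))"
    proof (rule configs_extend[where q = q])
      show "v 0 \<in> configs \<phi> \<psi> p n" using v(1)[of 0] by (simp add: M_def)
      show "v k \<in> cyl (v 0) n" for k using v(1)[of k] by (simp add: s M_def)
    qed (use q y v in \<open>simp_all add: z_def\<close>)
    then obtain u where "u \<in> configs \<phi> \<psi> p (Suc n) \<inter> cyl s n"
      "\<And>i. inner u i = inner (v 0) i \<or> (\<exists>k. inner u i = inner (v k) (parent n))" unfolding s by blast
    moreover have "\<phi> (inner (v k) i) \<notin> B" for k i using v(1)[of k] by (simp add: M_def)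
    ultimately show False using none by metis
  qed
  ultimately have "\<exists>E. (\<forall>k. E k \<in> sets borel \<and> H k \<subseteq> E k) \<and>
      (\<forall>x y. (x, y) \<in> {(x, y). f x \<noteq> y} \<longrightarrow> (\<exists>k. x \<in> U k \<and> y \<notin> E k))"
    using U(1) by (intro cover_separation)
  then obtain E where E: "\<And>k. E k \<in> sets borel" "\<And>k. H k \<subseteq> E k" "\<And>x y. f x \<noteq> y \<Longrightarrow> \<exists>k. x \<in> U k \<and> y \<notin> E k"
    unfolding mem_Collect_eq prod.case by metis
  define C where "C = {x. \<forall>k. x \<in> U k \<longrightarrow> f x \<in> E k}"
  have "closed_fibred f C" unfolding C_def by (rule closed_fibred_cover[OF f U(1) E(1) E(3)])
  then have "small f (B \<union> C)" using B by (simp add: small_Un closed_fibred_small)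
  then obtain u where u: "u \<in> configs \<phi> \<psi> p n \<inter> cyl s n" "\<And>i. \<phi> (inner u i) \<notin> B \<union> C"
    using large unfolding large_def by blast
  then have "u \<in> M" by (simp add: M_def)
  then have "f (\<phi> (z u)) \<in> E k" if "\<phi> (z u) \<in> U k" for k
    using that E(2)[of k] \<psi> by (auto simp: H_def)
  then have "\<phi> (z u) \<in> C" by (simp add: C_def)
  with u(2)[of "parent n"] show False by (simp add: z_def)
qed

section \<open>Decomposition of the domain\<close>

text \<open>If the fibre were the union of countably many closed sets, then by the Baire category theorem one of
  them, \<open>F n\<close>, would contain all the inner points with codes in some cylinder around a code \<open>inner u i\<close>. But a
  late enough outer point with parent \<open>i\<close> has all its children there, so their limit would lie in \<open>F n\<close> as
  well, and thus in the fibre.\<close>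
lemma no_full_config:
  fixes f :: "'a::metric_space \<Rightarrow> 'b::t2_space"
  assumes cont: "continuous_on UNIV \<phi>" "continuous_on UNIV \<psi>"
    and \<psi>: "\<And>w. \<psi> w = f (\<phi> w)" and p: "range p = {(x, y). f x \<noteq> y}"
    and fib: "\<And>y. fsigma (f -` {y})"
  shows "(\<Inter>n. configs \<phi> \<psi> p n) = {}"
proof (rule ccontr)
  assume "\<not> ?thesis"
  then obtain u where u: "\<And>n. u \<in> configs \<phi> \<psi> p n" by blast
  define y where "y = \<psi> (inner u 0)"
  have Wy: "\<psi> (inner u i) = y" for i using u[of 0] by (simp add: configs_def y_def)
  have Xy: "snd (p (outer u j)) = y"
    and near: "dist (\<phi> (inner u (child j k))) (fst (p (outer u j))) \<le> 1 / Suc k"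
    and agree: "prod_encode (2 * parent j, l) < j \<Longrightarrow> inner u (child j k) l = inner u (parent j) l" for j k l
    using u[of "Suc j"] by (simp_all add: configs_def y_def)
  define P where "P = closure (range (inner u))"
  have P: "closed P" "P \<noteq> {}" by (simp_all add: P_def)
  obtain F where F: "\<And>n::nat. closed (F n)" "f -` {y} = (\<Union>n. F n)"
    using fib[of y] unfolding fsigma.simps by blast
  have "closed (\<psi> -` {y})" using cont(2) by (intro closed_vimage) auto
  then have "P \<subseteq> \<psi> -` {y}" unfolding P_def using Wy by (intro closure_minimal) auto
  then have "P \<subseteq> \<phi> -` (f -` {y})" using \<psi> by auto
  then have "P \<subseteq> (\<Union>n. \<phi> -` F n)" unfolding F(2) vimage_UN .
  moreover have "closed (\<phi> -` F n)" for n using cont(1) F(1) by (intro closed_vimage)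
  ultimately obtain n w m where w: "w \<in> P" "P \<inter> cyl w m \<subseteq> \<phi> -` F n"
    using baire_closed_cover[OF P, of "\<lambda>n. \<phi> -` F n"] by blast
  have "cyl w m \<inter> range (inner u) \<noteq> {}"
    using w(1) cyl_self[of w m] open_Int_closure_eq_empty[OF open_cyl] unfolding P_def by blast
  then obtain i where "inner u i \<in> cyl w m" by blast
  have "finite ((\<lambda>l. prod_encode (2 * i, l)) ` {..<m})" by simp
  then obtain N where N: "\<And>l. l < m \<Longrightarrow> prod_encode (2 * i, l) < N"
    by (auto simp: finite_nat_set_iff_bounded)
  define j where "j = prod_encode (i, N)"
  have j: "parent j = i" "N \<le> j" by (simp_all add: j_def le_prod_encode_2)
  have "inner u (child j k) \<in> cyl w m" for k
    using agree[where j = j] N j \<open>inner u i \<in> cyl w m\<close> by (fastforce simp: cyl_def)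
  moreover have "inner u (child j k) \<in> P" for k
    unfolding P_def by (rule subsetD[OF closure_subset rangeI])
  ultimately have "inner u (child j k) \<in> P \<inter> cyl w m" for k by simp
  then have inF: "\<phi> (inner u (child j k)) \<in> F n" for k using subsetD[OF w(2)] by simp
  have lim: "(\<lambda>k. \<phi> (inner u (child j k))) \<longlonglongrightarrow> fst (p (outer u j))"
  proof (rule metric_LIMSEQ_I)
    fix e :: real assume "e > 0"
    then obtain N where N: "1 / real (Suc N) < e" using nat_approx_posE by blast
    have "dist (\<phi> (inner u (child j k))) (fst (p (outer u j))) < e" if "k \<ge> N" for k
    proof -
      have "1 / real (Suc k) \<le> 1 / real (Suc N)" using that by (simp add: frac_le)
      with near[of j k] N show ?thesis by linarith
    qed
    then show "\<exists>N. \<forall>k\<ge>N. dist (\<phi> (inner u (child j k))) (fst (p (outer u j))) < e" by blast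
  qed
  have "fst (p (outer u j)) \<in> F n" by (rule closed_sequentially[OF F(1) inF lim])
  then have "f (fst (p (outer u j))) = y" using F(2) by blast
  moreover have "p (outer u j) \<in> {(x, y). f x \<noteq> y}" using p rangeI[of p "outer u j"] by simp
  ultimately show False using Xy by (auto simp: split_beta)
qed

instance prod :: (polish_space, polish_space) polish_space ..

text \<open>If the domain is not small then all configurations together are large, as constant ones exist at
  every point. A branch of large cylinders gives a sequence each neighbourhood of which contains
  configurations that meet any given number of demands; since these are closed conditions, it meets all
  of them.\<close>
lemma small_UNIV:
  fixes f :: "'a::polish_space \<Rightarrow> 'b::polish_space"
  assumes f: "f \<in> borel_measurable borel" and fib: "\<And>y. fsigma (f -` {y})"
  shows "small f UNIV"
proof (rule ccontr)
  assume not_small: "\<not> small f UNIV"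
  have eq: "{z \<in> space (borel :: ('a \<times> 'b) measure). f (fst z) = snd z} \<in> sets borel"
  proof -
    have "(\<lambda>z :: 'a \<times> 'b. f (fst z)) \<in> borel_measurable borel"
      by (rule measurable_compose[OF borel_measurable_continuous_onI f]) (intro continuous_intros)
    moreover have "(snd :: 'a \<times> 'b \<Rightarrow> 'b) \<in> borel_measurable borel"
      by (rule borel_measurable_continuous_onI) (intro continuous_intros)
    ultimately have "(\<lambda>z. dist (f (fst z)) (snd z)) \<in> borel_measurable (borel :: ('a \<times> 'b) measure)"
      by (rule borel_measurable_dist)
    from measurable_sets[OF this, of "{0}"] show ?thesis
      by (simp add: vimage_def)
  qed
  then have graph: "{(x, y). f x = y} \<in> sets (borel :: ('a \<times> 'b) measure)"
    by (simp add: case_prod_unfold)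
  then have cograph: "{(x, y). f x \<noteq> y} \<in> sets (borel :: ('a \<times> 'b) measure)"
    using borel_comp[OF graph] by (simp add: Compl_eq case_prod_unfold)
  have "{(x, y). f x = y} \<noteq> {}" by auto
  then obtain g :: "(nat \<Rightarrow> nat) \<Rightarrow> 'a \<times> 'b" where g: "continuous_on UNIV g" "range g = {(x, y). f x = y}"
    using analytic_set_range[OF borel_analytic_set[OF graph]] by blast
  have "{(x, y). f x \<noteq> y} \<noteq> {}"
  proof
    assume empty: "{(x, y). f x \<noteq> y} = {}"
    have "closed_fibred f UNIV"
      unfolding closed_fibred_def
    proof (intro conjI allI)
      have "f -` {y} = UNIV" for y using empty by auto
      then show "closed (UNIV \<inter> f -` {y})" for y by simp
    qed simp
    with not_small show False using closed_fibred_small by blast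
  qed
  then obtain p :: "(nat \<Rightarrow> nat) \<Rightarrow> 'a \<times> 'b" where p: "continuous_on UNIV p" "range p = {(x, y). f x \<noteq> y}"
    using analytic_set_range[OF borel_analytic_set[OF cograph]] by blast
  define \<phi> where "\<phi> w = fst (g w)" for w
  define \<psi> where "\<psi> w = snd (g w)" for w
  have cont: "continuous_on UNIV \<phi>" "continuous_on UNIV \<psi>"
    unfolding \<phi>_def \<psi>_def by (intro continuous_intros g(1))+
  have \<psi>: "\<psi> w = f (\<phi> w)" for w
  proof -
    have "g w \<in> {(x, y). f x = y}" using g(2) rangeI[of g w] by simp
    then show ?thesis by (auto simp: \<phi>_def \<psi>_def)
  qed
  have onto: "\<exists>w. \<phi> w = x" for x
  proof -
    have "(x, f x) \<in> range g" using g(2) by simp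
    then show ?thesis unfolding \<phi>_def by (metis fst_conv imageE)
  qed
  have "\<exists>u. \<forall>n. large f \<phi> \<psi> p n (cyl u n)"
  proof (rule cyl_branch)
    show "large f \<phi> \<psi> p 0 UNIV"
      unfolding large_def
    proof (intro allI impI)
      fix B assume "small f B"
      then have "B \<noteq> UNIV" using not_small by blast
      then obtain w where w: "\<phi> w \<notin> B" using onto by (metis UNIV_eq_I)
      show "\<exists>u\<in>configs \<phi> \<psi> p 0 \<inter> UNIV. \<forall>i. \<phi> (inner u i) \<notin> B"
        using w by (intro bexI[of _ "interleave (\<lambda>_. w)"]) (auto simp: configs_def)
    qed
    show "\<exists>v\<in>cyl u n. large f \<phi> \<psi> p (Suc n) (cyl v (Suc n))" if "large f \<phi> \<psi> p n (cyl u n)" for n u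
      by (rule large_split[OF large_extend[OF f cont p(1) \<psi> p(2) that]])
  qed
  then obtain u where u: "\<And>n. large f \<phi> \<psi> p n (cyl u n)" by blast
  have "small f {}" unfolding small_def by (intro exI[of _ "{}"]) auto
  then have ne: "cyl u n \<inter> configs \<phi> \<psi> p n \<noteq> {}" for n
    using u[of n] unfolding large_def by blast
  have "u \<in> configs \<phi> \<psi> p m" for m
  proof (rule mem_closed_cylI[OF closed_configs[OF cont p(1)]])
    fix n
    show "cyl u n \<inter> configs \<phi> \<psi> p m \<noteq> {}"
      using ne[of "max m n"] cyl_mono[of n "max m n" u] configs_antimono[of m "max m n" \<phi> \<psi> p] by auto
  qed
  then show False using no_full_config[OF cont \<psi> p(2) fib] by blast
qed

theorem theoremA6:
  fixes f :: "'a::polish_space \<Rightarrow> 'b::polish_space"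
  assumes "f \<in> borel_measurable borel"
    and "fsigma_to_one f"
  shows "strongly_sigma_closed_to_one f"
proof -
  have "small f UNIV"
    using small_UNIV[OF assms(1)] assms(2) by (simp add: fsigma_to_one_def)
  then obtain \<C> where \<C>: "countable \<C>" "\<And>C. C \<in> \<C> \<Longrightarrow> closed_fibred f C" "UNIV = \<Union>\<C>"
    unfolding small_def by blast
  then have "\<C> \<noteq> {}" by auto
  then obtain A :: "nat \<Rightarrow> 'a set" where A: "range A = \<C>" using \<C>(1) uncountable_def by metis
  have "closed_fibred f (A n)" for n using A \<C>(2) by blast
  then show ?thesis
    unfolding strongly_sigma_closed_to_one_def
    using A \<C>(3)[symmetric] by (intro exI[of _ A]) (auto simp: closed_fibred_def borel_analytic_set)
qed

end
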